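(* Let $n\ge 5$. The maximum of the total chord length $TCL(G)$ over all maximal outerplanar graphs $G$ of order $n$ equals \[ \frac{n^2-9}{4} \text{ if } n \text{ is odd},\qquad \frac{n^2-8}{4} \text{ if } n \text{ is even}. \]
   Context: A maximal outerplanar graph of order $n$ is regarded as a drawing consisting of an $n$-cycle $\mathcal{C}$ in the plane together with a triangulation (by non-crossing edges between vertices of $\mathcal{C}$) of the bounded region determined by $\mathcal{C}$; all $n$ vertices lie on $\mathcal{C}$. The edges not belonging to $\mathcal{C}$ are called chords (there are $n-3$ of them). The length of a chord is the length (number of edges) of a shortest path in $\mathcal{C}$ between its endpoints. The total chord length $TCL(G)$ is the sum of the lengths of all chords of $G$. *)

theory Defs
  imports "HOL-Analysis.Analysis"
begin

text \<open>
  The outer cycle is drawn as a Jordan curve \<open>outer G\<close>. Its vertices are named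
  \<open>0, \<dots>, n - 1\<close> in the order in which they occur along the curve; vertex \<open>i\<close> is the
  point with parameter \<open>mark G i\<close>, and the cycle edges are the parts of the curve between
  consecutive vertices. A chord is a two-element set of vertices, drawn as the curve
  \<open>chord_path G e\<close>; curves need not be straight.
\<close>

record drawing =
  outer :: "real \<Rightarrow> complex"
  mark :: "nat \<Rightarrow> real"
  chords :: "nat set set"
  chord_path :: "nat set \<Rightarrow> real \<Rightarrow> complex"

definition vertex :: "drawing \<Rightarrow> nat \<Rightarrow> complex" where
  "vertex G i = outer G (mark G i)"

definition cycle_edges :: "nat \<Rightarrow> nat set set" where
  "cycle_edges n = {{i, Suc i mod n} | i. i < n}"

definition outerplane_drawing :: "nat \<Rightarrow> drawing \<Rightarrow> bool" where
  "outerplane_drawing n G \<longleftrightarrow>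
     simple_path (outer G) \<and> pathfinish (outer G) = pathstart (outer G) \<and>
     mark G ` {..<n} \<subseteq> {0..<1} \<and> strict_mono_on {..<n} (mark G) \<and>
     (\<forall>e\<in>chords G.
        e \<subseteq> {..<n} \<and> card e = 2 \<and> e \<notin> cycle_edges n \<and>
        arc (chord_path G e) \<and>
        {pathstart (chord_path G e), pathfinish (chord_path G e)} = vertex G ` e \<and>
        path_image (chord_path G e) - vertex G ` e \<subseteq> inside (path_image (outer G))) \<and>
     (\<forall>e\<in>chords G. \<forall>f\<in>chords G. e \<noteq> f \<longrightarrow>
        path_image (chord_path G e) \<inter> path_image (chord_path G f) \<subseteq> vertex G ` (e \<inter> f))"

text \<open>
  The chords triangulate the region bounded by the cycle if they form a maximal set of
  non-crossing chords: no pair of vertices that is not yet adjacent can be joined by a further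
  curve inside the region.
\<close>

definition maximal_outerplanar :: "nat \<Rightarrow> drawing \<Rightarrow> bool" where
  "maximal_outerplanar n G \<longleftrightarrow>
     outerplane_drawing n G \<and>
     \<not> (\<exists>e g. e \<notin> chords G \<and>
          outerplane_drawing n
            (G\<lparr>chords := insert e (chords G), chord_path := (chord_path G)(e := g)\<rparr>))"

text \<open>The relational power \<open>^^ k\<close> expresses that there is a walk with \<open>k\<close> edges; a shortest
  walk is a shortest path.\<close>

definition chord_length :: "nat \<Rightarrow> nat set \<Rightarrow> nat" where
  "chord_length n e =
     (LEAST k. \<exists>i j. e = {i, j} \<and> (i, j) \<in> {(u, v). {u, v} \<in> cycle_edges n} ^^ k)"

definition TCL :: "nat \<Rightarrow> drawing \<Rightarrow> nat" where
  "TCL n G = (\<Sum>e\<in>chords G. chord_length n e)"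

definition TCL_values :: "nat \<Rightarrow> nat set" where
  "TCL_values n = {TCL n G | G. maximal_outerplanar n G}"

end

theory Submission
  imports Defs "HOL-Complex_Analysis.Contour_Integration"
begin

text \<open>
  Two chords with interleaving endpoints must meet: the first one cuts the inside of the Jordan
  curve into two open pieces, and the endpoints of the second one lie on the boundaries of
  different pieces. So the chords form a non-crossing family of pairs on the cycle, and such a
  family contains at most \<open>n - 1 - 2 * k\<close> chords of length greater than \<open>k\<close>, for every \<open>k \<ge> 1\<close>.
  Summing over \<open>k\<close> bounds the total length by \<open>n\<^sup>2 div 4 - 2\<close>. The straight zigzag triangulation of
  the regular \<open>n\<close>-gon attains all these bounds at once. It has \<open>n - 3\<close> chords, which by the case
  \<open>k = 1\<close> is the largest possible number, and hence it is maximal.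
\<close>

section \<open>Crossing chords\<close>

text \<open>Continuity carries the closure of the open unit interval into the closure of its image.
  This places both endpoints of a chord in the closure of whichever region holds the rest of
  it.\<close>

lemma arc_subset_closure_minus_endpoints:
  fixes h :: "real \<Rightarrow> 'a::metric_space"
  assumes "arc h"
  shows "path_image h \<subseteq> closure (path_image h - {pathstart h, pathfinish h})"
proof -
  have "h ` closure {0<..<1} \<subseteq> closure (h ` {0<..<1})"
  proof (rule image_closure_subset)
    show "continuous_on (closure {0<..<1}) h"
      using assms by (simp add: arc_def path_def)
  qed (auto simp: closure_subset)
  then show ?thesis
    using simple_path_endless[OF arc_imp_simple_path[OF assms]]
    by (simp add: path_image_def)
qed

text \<open>A theta-curve argument: \<open>g\<close> splits the inside of \<open>q\<close> into two
  open pieces, bounded by \<open>g\<close> and one part of \<open>q\<close> each. If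
  \<open>h\<close> avoided \<open>g\<close>, its connected interior would lie in a single piece,
  whose closure misses one of \<open>q u\<close>, \<open>q v\<close>.\<close>

lemma crossing_arcs_meet_oriented:
  fixes q g h :: "real \<Rightarrow> complex"
  assumes q: "simple_path q" "pathfinish q = pathstart q"
    and ord: "0 < u" "u < s" "s < v" "v < 1"
    and g: "arc g" "pathstart g = q 0" "pathfinish g = q s"
      "path_image g - {q 0, q s} \<subseteq> inside (path_image q)"
    and h: "arc h" "{pathstart h, pathfinish h} = {q u, q v}"
      "path_image h - {q u, q v} \<subseteq> inside (path_image q)"
  shows "path_image g \<inter> path_image h \<noteq> {}"
proof
  assume disj: "path_image g \<inter> path_image h = {}"
  have q01: "q 1 = q 0" using q(2) by (simp add: pathstart_def pathfinish_def)
  have qinj: "x = y \<or> x = 0 \<and> y = 1 \<or> x = 1 \<and> y = 0"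
    if "q x = q y" "x \<in> {0..1}" "y \<in> {0..1}" for x y
    using q(1) that by (auto simp: simple_path_def loop_free_def)
  define c1 where "c1 = subpath 0 s q"
  \<comment> \<open>Reversal makes \<open>c1\<close>, \<open>c2\<close> and \<open>g\<close> all run
    from \<open>q 0\<close> to \<open>q s\<close>, as the splitting theorem requires.\<close>
  define c2 where "c2 = reversepath (subpath s 1 q)"
  have im1: "path_image c1 = q ` {0..s}" and im2: "path_image c2 = q ` {s..1}"
    using ord by (auto simp: c1_def c2_def path_image_subpath)
  have ne: "q 0 \<noteq> q s" using qinj[of 0 s] ord by auto
  have a1: "arc c1" unfolding c1_def using q(1) ne ord by (intro arc_simple_path_subpath) auto
  have "arc (subpath s 1 q)" using q(1) ne q01 ord by (intro arc_simple_path_subpath) auto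
  then have a2: "arc c2" unfolding c2_def by (rule arc_reversepath)
  have "{0..s} \<union> {s..1} = {0..1}" using ord by auto
  then have un: "path_image c1 \<union> path_image c2 = path_image q"
    unfolding im1 im2 by (simp add: path_image_def flip: image_Un)
  have int: "path_image c1 \<inter> path_image c2 = {q 0, q s}"
  proof
    show "path_image c1 \<inter> path_image c2 \<subseteq> {q 0, q s}"
    proof
      fix z assume "z \<in> path_image c1 \<inter> path_image c2"
      then obtain x y where "x \<in> {0..s}" "y \<in> {s..1}" "z = q x" "z = q y"
        unfolding im1 im2 by auto
      with qinj[of x y] ord show "z \<in> {q 0, q s}" by auto
    qed
    have "q 0 \<in> q ` {s..1}" using q01 ord by (intro image_eqI[of _ _ 1]) auto
    then show "{q 0, q s} \<subseteq> path_image c1 \<inter> path_image c2"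
      using ord by (auto simp: im1 im2)
  qed
  have g0: "q 0 \<in> path_image g" "q s \<in> path_image g"
    using g(2,3) pathstart_in_path_image[of g] pathfinish_in_path_image[of g] by auto
  have gq: "path_image g \<inter> path_image q \<subseteq> {q 0, q s}"
    using g(4) inside_no_overlap[of "path_image q"] by blast
  have c1g: "path_image c1 \<inter> path_image g = {q 0, q s}"
    using gq un int g0 by blast
  have c2g: "path_image c2 \<inter> path_image g = {q 0, q s}"
    using gq un int g0 by blast
  \<comment> \<open>The midpoint of \<open>g\<close> witnesses that \<open>g\<close> really enters
    the inside of \<open>q\<close>.\<close>
  have "g (1/2) \<in> path_image g - {q 0, q s}"
    using g(2,3)[symmetric] inj_onD[of g "{0..1}" "1/2" 0] inj_onD[of g "{0..1}" "1/2" 1] g(1)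
    by (auto simp: path_image_def arc_def pathstart_def pathfinish_def)
  then have ne12: "path_image g \<inter> inside (path_image c1 \<union> path_image c2) \<noteq> {}"
    using g(4) un by auto
  let ?I1 = "inside (path_image c1 \<union> path_image g)"
  let ?I2 = "inside (path_image c2 \<union> path_image g)"
  have s1: "pathstart c1 = q 0" "pathfinish c1 = q s"
    and s2: "pathstart c2 = q 0" "pathfinish c2 = q s"
    by (auto simp: c1_def c2_def q01)
  have I12: "?I1 \<inter> ?I2 = {}"
    and IU: "?I1 \<union> ?I2 \<union> (path_image g - {q 0, q s}) = inside (path_image q)"
    using split_inside_simple_closed_curve[OF arc_imp_simple_path[OF a1] s1
        arc_imp_simple_path[OF a2] s2 arc_imp_simple_path[OF g(1)] g(2,3) ne int c1g c2g ne12]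
    unfolding un by metis+
  have cl1: "closed (path_image c1 \<union> path_image g)" and cl2: "closed (path_image c2 \<union> path_image g)"
    using a1 a2 g(1) by (auto intro!: closed_Un closed_path_image arc_imp_path)
  let ?H = "path_image h - {q u, q v}"
  have Hconn: "connected ?H"
    using connected_simple_path_endless[OF arc_imp_simple_path[OF h(1)]] h(2) by simp
  have Hsub: "?H \<subseteq> ?I1 \<union> ?I2" using h(3) IU disj by blast
  have h0: "{q u, q v} \<subseteq> path_image h"
    unfolding h(2)[symmetric] by (simp add: pathstart_in_path_image pathfinish_in_path_image)
  then have Hcl: "q u \<in> closure ?H" "q v \<in> closure ?H"
    using arc_subset_closure_minus_endpoints[OF h(1)] h(2) by auto
  \<comment> \<open>The closure of a piece adds at most its bounding curve. So \<open>q u\<close>,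
    lying on neither \<open>c2\<close> nor \<open>g\<close>, stays away from the second piece, and
    \<open>q v\<close> likewise from the first.\<close>
  have "q u \<notin> path_image g" "q v \<notin> path_image g"
    using disj h0 by auto
  moreover have "q u \<notin> path_image c2" "q v \<notin> path_image c1"
    using qinj ord unfolding im1 im2 by fastforce+
  moreover have "q u \<in> path_image q" "q v \<in> path_image q"
    using ord by (auto simp: path_image_def)
  then have "q u \<notin> ?I2" "q v \<notin> ?I1"
    using IU inside_no_overlap[of "path_image q"] by blast+
  ultimately have "q u \<notin> closure ?I2" "q v \<notin> closure ?I1"
    using closure_inside_subset[OF cl1] closure_inside_subset[OF cl2] by blast+
  moreover have "?I1 \<inter> ?H = {} \<or> ?I2 \<inter> ?H = {}"
    using Hconn Hsub I12 open_inside[OF cl1] open_inside[OF cl2] unfolding connected_def by blast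
  then have "?H \<subseteq> ?I1 \<or> ?H \<subseteq> ?I2" using Hsub by blast
  ultimately show False using Hcl closure_mono by blast
qed

text \<open>A chord is an unordered pair, so the direction of \<open>g\<close> is unknown; reversing
  it changes nothing. The hypotheses on \<open>h\<close> are already symmetric.\<close>

lemma crossing_arcs_meet:
  fixes q g h :: "real \<Rightarrow> complex"
  assumes q: "simple_path q" "pathfinish q = pathstart q"
    and ord: "0 < u" "u < s" "s < v" "v < 1"
    and g: "arc g" "{pathstart g, pathfinish g} = {q 0, q s}"
      "path_image g - {q 0, q s} \<subseteq> inside (path_image q)"
    and h: "arc h" "{pathstart h, pathfinish h} = {q u, q v}"
      "path_image h - {q u, q v} \<subseteq> inside (path_image q)"
  shows "path_image g \<inter> path_image h \<noteq> {}"
proof (cases "pathstart g = q 0")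
  case True
  with g(1,2) have "pathfinish g = q s" by (metis doubleton_eq_iff)
  with True show ?thesis using crossing_arcs_meet_oriented assms by blast
next
  case False
  with g(2) have "pathfinish g = q 0" "pathstart g = q s" by (metis doubleton_eq_iff)+
  then show ?thesis
    using crossing_arcs_meet_oriented[OF q ord arc_reversepath[OF g(1)] _ _ _ h] g(3) by simp
qed

lemma strict_mono_on_lessThanD:
  "strict_mono_on {..<n} f \<Longrightarrow> i < j \<Longrightarrow> j < (n::nat) \<Longrightarrow> f i < f j"
  by (auto simp: strict_mono_on_def)

lemma outerplane_chords_not_crossing:
  assumes G: "outerplane_drawing n G"
    and ac: "{a, c} \<in> chords G" and bd: "{b, d} \<in> chords G"
    and ord: "a < b" "b < c" "c < d"
  shows False
proof -
  let ?m = "mark G"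
  have p: "simple_path (outer G)" "pathfinish (outer G) = pathstart (outer G)"
    and mono: "strict_mono_on {..<n} ?m" and rng: "?m ` {..<n} \<subseteq> {0..<1}"
    using G by (auto simp: outerplane_drawing_def)
  have ch: "e \<subseteq> {..<n} \<and> arc (chord_path G e) \<and>
        {pathstart (chord_path G e), pathfinish (chord_path G e)} = vertex G ` e \<and>
        path_image (chord_path G e) - vertex G ` e \<subseteq> inside (path_image (outer G))"
    if "e \<in> chords G" for e
    using G that by (auto simp: outerplane_drawing_def)
  have n: "d < n" using ch[OF bd] by auto
  have m: "?m a < ?m b" "?m b < ?m c" "?m c < ?m d"
    using ord n by (auto intro!: strict_mono_on_lessThanD[OF mono])
  have m01: "0 \<le> ?m a" "?m d < 1" using rng ord n by (auto simp: image_subset_iff)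
  \<comment> \<open>Moving the base point of the closed curve to vertex \<open>a\<close> gives
    \<open>a\<close> parameter 0 and keeps the order of \<open>b\<close>, \<open>c\<close>,
    \<open>d\<close>.\<close>
  define q where "q = shiftpath (?m a) (outer G)"
  have q: "simple_path q" "pathfinish q = pathstart q" "path_image q = path_image (outer G)"
    using p m m01 unfolding q_def
    by (auto simp: simple_path_shiftpath pathfinish_shiftpath pathstart_shiftpath path_image_shiftpath)
  have qv: "q 0 = vertex G a" "q (?m b - ?m a) = vertex G b" "q (?m c - ?m a) = vertex G c"
      "q (?m d - ?m a) = vertex G d"
    using m m01 by (auto simp: q_def shiftpath_def vertex_def)
  have "path_image (chord_path G {a, c}) \<inter> path_image (chord_path G {b, d}) \<noteq> {}"
    using ch[OF ac] ch[OF bd] m m01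
    by (intro crossing_arcs_meet[OF q(1,2), of "?m b - ?m a" "?m c - ?m a" "?m d - ?m a"])
       (simp_all add: q(3) qv)
  moreover have "path_image (chord_path G {a, c}) \<inter> path_image (chord_path G {b, d})
      \<subseteq> vertex G ` ({a, c} \<inter> {b, d})"
  proof -
    have "{a, c} \<noteq> {b, d}" using ord by (auto simp: doubleton_eq_iff)
    moreover have "\<forall>e\<in>chords G. \<forall>f\<in>chords G. e \<noteq> f \<longrightarrow>
        path_image (chord_path G e) \<inter> path_image (chord_path G f) \<subseteq> vertex G ` (e \<inter> f)"
      using G unfolding outerplane_drawing_def by (elim conjE)
    ultimately show ?thesis using ac bd by simp
  qed
  moreover have "{a, c} \<inter> {b, d} = {}" using ord by auto
  ultimately show False by auto
qed

section \<open>Non-crossing families on a cycle\<close>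

definition noncrossing :: "(nat \<times> nat) set \<Rightarrow> bool" where
  "noncrossing S \<longleftrightarrow> (\<forall>a b c d. (a, c) \<in> S \<longrightarrow> (b, d) \<in> S \<longrightarrow> \<not> (a < b \<and> b < c \<and> c < d))"

lemma noncrossingD:
  "noncrossing S \<Longrightarrow> (a, c) \<in> S \<Longrightarrow> (b, d) \<in> S \<Longrightarrow> \<not> (a < b \<and> b < c \<and> c < d)"
  unfolding noncrossing_def by blast

lemma noncrossing_subset: "noncrossing S \<Longrightarrow> T \<subseteq> S \<Longrightarrow> noncrossing T"
  unfolding noncrossing_def by blast

text \<open>Induction on the length of the interval. Apart from \<open>(a, b)\<close> itself, either
  no pair starts at \<open>a\<close> and the interval shrinks by one, or the longest pair
  \<open>(a, j)\<close> divides the rest between \<open>[a, j]\<close> and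
  \<open>[j, b]\<close>.\<close>

lemma card_noncrossing_interval:
  fixes k :: nat
  assumes "k \<ge> 1" "noncrossing S"
    and "\<And>x y. (x, y) \<in> S \<Longrightarrow> a \<le> x \<and> x + k < y \<and> y \<le> b"
  shows "card S \<le> b - a - k"
  using assms(2,3)
proof (induction "b - a" arbitrary: a b S rule: less_induct)
  case less
  show ?case
  proof (cases "S = {}")
    case False
    then have ab: "a + k < b" using less.prems(2) by fastforce
    have fin: "finite S"
      using less.prems(2) by (intro finite_subset[of S "{..b} \<times> {..b}"]) fastforce+
    define S' where "S' = S - {(a, b)}"
    have nc': "noncrossing S'" and fin': "finite S'"
      using less.prems(1) fin noncrossing_subset[of S S'] by (auto simp: S'_def)
    have S': "a \<le> x \<and> x + k < y \<and> y \<le> b \<and> (x, y) \<noteq> (a, b)" if "(x, y) \<in> S'" for x y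
      using that less.prems(2)[of x y] by (auto simp: S'_def)
    have "card S' \<le> b - a - k - 1"
    proof (cases "\<exists>y. (a, y) \<in> S'")
      case False
      have "card S' \<le> b - (a + 1) - k"
      proof (rule less.hyps[OF _ nc'])
        fix x y assume xy: "(x, y) \<in> S'"
        with False have "x \<noteq> a" by auto
        with S'[OF xy] show "a + 1 \<le> x \<and> x + k < y \<and> y \<le> b" by auto
      qed (use ab in auto)
      then show ?thesis by simp
    next
      case True
      define j where "j = Max {y. (a, y) \<in> S'}"
      have finY: "finite {y. (a, y) \<in> S'}"
        by (rule finite_subset[of _ "{..b}"]) (use S' in blast)+
      have jS: "(a, j) \<in> S'" using Max_in[OF finY] True by (auto simp: j_def)
      have jmax: "y \<le> j" if "(a, y) \<in> S'" for y using Max_ge[OF finY] that by (simp add: j_def)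
      have j: "a + k < j" "j < b" using S'[OF jS] by auto
      define S1 where "S1 = {e \<in> S'. snd e \<le> j}"
      define S2 where "S2 = {e \<in> S'. j \<le> fst e}"
      have "S' \<subseteq> S1 \<union> S2"
      proof
        fix e assume e: "e \<in> S'"
        obtain x y where xy: "e = (x, y)" by (cases e)
        \<comment> \<open>A pair ending beyond \<open>j\<close> cannot start at \<open>a\<close>, by
          the choice of \<open>j\<close>, nor strictly between \<open>a\<close> and
          \<open>j\<close>, as it would cross \<open>(a, j)\<close>.\<close>
        have "y \<le> j \<or> j \<le> x"
          using noncrossingD[OF nc' jS, of x y] e S'[of x y] jmax[of y] xy by force
        then show "e \<in> S1 \<union> S2" using e xy by (auto simp: S1_def S2_def)
      qed
      moreover have "finite S1" "finite S2" using fin' by (auto simp: S1_def S2_def)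
      ultimately have "card S' \<le> card S1 + card S2"
        by (meson card_Un_le card_mono finite_UnI le_trans)
      also have "card S1 \<le> j - a - k"
        by (rule less.hyps) (use j S' noncrossing_subset[OF nc'] in \<open>auto simp: S1_def\<close>)
      also have "card S2 \<le> b - j - k"
        by (rule less.hyps) (use j S' noncrossing_subset[OF nc'] in \<open>auto simp: S2_def\<close>)
      finally have "card S' \<le> (j - a - k) + (b - j - k)" by simp
      \<comment> \<open>If \<open>b - j\<close> is at least \<open>k\<close>, then \<open>k\<close>
        is subtracted twice, and \<open>k \<ge> 1\<close> gives the missing 1. Otherwise the second
        term truncates to 0 and \<open>j < b\<close> gives it.\<close>
      then show ?thesis using j assms(1) by linarith
    qed
    moreover have "card S \<le> Suc (card S')"
      unfolding S'_def card_Diff_singleton_if by (cases "(a, b) \<in> S") simp_all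
    ultimately show ?thesis using ab by linarith
  qed simp
qed

text \<open>
  Cutting the cycle open at a shortest pair of \<open>S\<close> puts all of \<open>S\<close> on the complementary
  interval, whose length is at most \<open>n - 1 - k\<close>.
\<close>

lemma card_noncrossing_cyclic:
  fixes k :: nat
  assumes k: "k \<ge> 1" and nc: "noncrossing S"
    and S: "\<And>x y. (x, y) \<in> S \<Longrightarrow> x + k < y \<and> y < n \<and> y - x + k < n"
  shows "card S \<le> n - 1 - 2 * k"
proof (cases "S = {}")
  case False
  then obtain e where e: "e \<in> S" "\<And>f. f \<in> S \<Longrightarrow> snd e - fst e \<le> snd f - fst f"
    using ex_has_least_nat[of "\<lambda>e. e \<in> S" _ "\<lambda>e. snd e - fst e"] by (meson ex_in_conv)
  obtain i j where ij: "e = (i, j)" by (cases e)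
  have ijS: "(i, j) \<in> S" and least: "\<And>x y. (x, y) \<in> S \<Longrightarrow> j - i \<le> y - x"
    using e ij by force+
  have bij: "i + k < j" "j < n" "j - i + k < n" using S[OF ijS] by auto
  \<comment> \<open>Minimality of \<open>j - i\<close> excludes any other pair between
    \<open>i\<close> and \<open>j\<close>; non-crossing excludes partial overlap.\<close>
  have pos: "y \<le> i \<or> j \<le> x \<or> (x \<le> i \<and> j \<le> y)" if "(x, y) \<in> S" for x y
    using noncrossingD[OF nc ijS that] noncrossingD[OF nc that ijS] least[OF that] S[OF that] bij
    by linarith
  \<comment> \<open>The rotation taking \<open>j\<close> to 0 and \<open>i\<close> to
    \<open>n - j + i\<close>. A pair around \<open>(i, j)\<close> has its endpoints interchanged,
    because \<open>n - 1\<close> and 0 become neighbours.\<close>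
  define r where "r = (\<lambda>(x, y). if y \<le> i then (x + n - j, y + n - j)
    else if j \<le> x then (x - j, y - j) else (y - j, x + n - j))"
  have r: "(y \<le> i \<and> a + j = x + n \<and> c + j = y + n) \<or> (j \<le> x \<and> a + j = x \<and> c + j = y)
      \<or> (x \<le> i \<and> j \<le> y \<and> a + j = y \<and> c + j = x + n)"
    if "(x, y) \<in> S" "r (x, y) = (a, c)" for x y a c
    using pos[OF that(1)] S[OF that(1)] that(2) bij by (auto simp: r_def split: if_splits)
  have inj: "inj_on r S"
  proof (rule inj_onI, clarify)
    fix x y x' y' assume xy: "(x, y) \<in> S" and xy': "(x', y') \<in> S" and eq: "r (x, y) = r (x', y')"
    obtain a c where ac: "r (x, y) = (a, c)" by (cases "r (x, y)")
    then have "r (x', y') = (a, c)" using eq by simp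
    from r[OF xy ac] r[OF xy' this] S[OF xy] S[OF xy'] bij
    have "x = x'" "y = y'" by (elim disjE conjE; linarith)+
    then show "x = x' \<and> y = y'" ..
  qed
  have "noncrossing (r ` S)"
    unfolding noncrossing_def
  proof (intro allI impI notI)
    fix a b c d assume "(a, c) \<in> r ` S" "(b, d) \<in> r ` S" and abcd: "a < b \<and> b < c \<and> c < d"
    then obtain x y x' y' where xy: "(x, y) \<in> S" "r (x, y) = (a, c)"
      and xy': "(x', y') \<in> S" "r (x', y') = (b, d)" by force
    have "x' \<le> x \<or> y \<le> x' \<or> y' \<le> y" "x \<le> x' \<or> y' \<le> x \<or> y \<le> y'"
      using noncrossingD[OF nc xy(1) xy'(1)] noncrossingD[OF nc xy'(1) xy(1)] by auto
    moreover have "x < y" "y < n" "x' < y'" "y' < n" "i < j" "j < n"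
      using S[OF xy(1)] S[OF xy'(1)] bij by auto
    ultimately show False using r[OF xy] r[OF xy'] abcd
      by (elim disjE conjE; linarith)
  qed
  then have "card (r ` S) \<le> (n - j + i) - 0 - k"
  proof (rule card_noncrossing_interval[OF k])
    fix a c assume "(a, c) \<in> r ` S"
    then obtain x y where xy: "(x, y) \<in> S" "r (x, y) = (a, c)" by force
    \<comment> \<open>An interchanged pair has span \<open>n - (y - x)\<close>; the third bound on
      \<open>S\<close> makes this exceed \<open>k\<close>.\<close>
    with r[OF xy] S[OF xy(1)] bij show "0 \<le> a \<and> a + k < c \<and> c \<le> n - j + i"
      by auto
  qed
  then show ?thesis using card_image[OF inj] bij by linarith
qed simp

section \<open>Summation over length thresholds\<close>

text \<open>The discrete layer-cake formula: write \<open>f x\<close> as a sum of ones over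
  \<open>k < f x\<close> and exchange the sums.\<close>

lemma sum_eq_sum_card_less:
  fixes f :: "'a \<Rightarrow> nat"
  assumes "finite A" "\<And>x. x \<in> A \<Longrightarrow> f x \<le> N"
  shows "sum f A = (\<Sum>k<N. card {x \<in> A. k < f x})"
proof -
  have "sum f A = (\<Sum>x\<in>A. \<Sum>k<N. if k < f x then 1 else 0)"
  proof (rule sum.cong)
    fix x assume "x \<in> A"
    then have "{k \<in> {..<N}. k < f x} = {..<f x}" using assms(2)[of x] by auto
    then show "f x = (\<Sum>k<N. if k < f x then 1 else 0)"
      by (simp flip: sum.inter_filter)
  qed simp
  also have "\<dots> = (\<Sum>k<N. \<Sum>x\<in>A. if k < f x then 1 else 0)" by (rule sum.swap)
  also have "\<dots> = (\<Sum>k<N. card {x \<in> A. k < f x})"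
    using assms(1) by (simp flip: sum.inter_filter)
  finally show ?thesis .
qed

text \<open>The terms are \<open>n - 1\<close>, \<open>n - 3\<close>, and so on, truncated to 0
  afterwards. Removing the first term leaves the sum for \<open>n - 2\<close>, and the squares of
  \<open>n\<close> and \<open>n - 2\<close> differ by \<open>4 * (n - 1)\<close>.\<close>

lemma sum_odd_steps: "n \<le> N + 1 \<Longrightarrow> (\<Sum>k<N. n - 1 - 2 * k) = n\<^sup>2 div 4" for n N :: nat
proof (induction n arbitrary: N rule: less_induct)
  case (less n)
  show ?case
  proof (cases "n < 2")
    case True
    then have "n = 0 \<or> n = 1" by auto
    then show ?thesis by auto
  next
    case False
    then obtain m where m: "n = m + 2" by (metis add.commute le_Suc_ex not_less)
    with less.prems obtain M where M: "N = Suc M" by (cases N) auto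
    have "(\<Sum>k<N. n - 1 - 2 * k) = (n - 1) + (\<Sum>k<M. m - 1 - 2 * k)"
      unfolding M sum.lessThan_Suc_shift by (simp add: m)
    also have "(\<Sum>k<M. m - 1 - 2 * k) = m\<^sup>2 div 4" using less m M by simp
    also have "(n - 1) + m\<^sup>2 div 4 = n\<^sup>2 div 4" by (simp add: m power2_eq_square)
    finally show ?thesis .
  qed
qed

text \<open>Level \<open>k \<ge> 1\<close> of the layer-cake sum is bounded by
  \<open>n - 1 - 2 * k\<close>. Level 0 counts at most all pairs, and these number at most
  \<open>n - 3\<close> by the case \<open>k = 1\<close>.\<close>

lemma sum_noncrossing_le:
  assumes nc: "noncrossing S"
    and S: "\<And>x y. (x, y) \<in> S \<Longrightarrow> x + 1 < y \<and> y < n \<and> y - x + 1 < n"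
  shows "(\<Sum>(x, y)\<in>S. min (y - x) (n - (y - x))) \<le> n\<^sup>2 div 4 - 2"
proof (cases "n \<ge> 3")
  case n: True
  define f where "f = (\<lambda>(x, y). min (y - x) (n - (y - x)))"
  have fin: "finite S"
    using S by (intro finite_subset[of S "{..n} \<times> {..n}"]) fastforce+
  define c where "c k = card {e \<in> S. k < f e}" for k
  have c: "c k \<le> n - 1 - 2 * k" if "k \<ge> 1" for k
    unfolding c_def
  proof (rule card_noncrossing_cyclic[OF that noncrossing_subset[OF nc]])
    fix x y assume "(x, y) \<in> {e \<in> S. k < f e}"
    then show "x + k < y \<and> y < n \<and> y - x + k < n" using S[of x y] by (auto simp: f_def)
  qed auto
  have "card S \<le> n - 1 - 2 * 1"
    by (rule card_noncrossing_cyclic[OF _ nc S]) auto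
  moreover have "c 0 \<le> card S" unfolding c_def using fin by (intro card_mono) auto
  ultimately have c0: "c 0 \<le> n - 3" by simp
  obtain N where N: "n = Suc N" using n by (cases n) auto
  have "sum f S = (\<Sum>k<n. c k)"
    unfolding c_def using S by (intro sum_eq_sum_card_less fin) (auto simp: f_def)
  also have "\<dots> = c 0 + (\<Sum>k<N. c (Suc k))" unfolding N sum.lessThan_Suc_shift by simp
  also have "\<dots> \<le> (n - 3) + (\<Sum>k<N. n - 1 - 2 * Suc k)"
    using c0 by (intro add_mono sum_mono c) auto
  \<comment> \<open>The 2 lifts the bound at level 0 from \<open>n - 3\<close> to
    \<open>n - 1\<close>, which completes the regular pattern.\<close>
  also have "\<dots> + 2 = (\<Sum>k<n. n - 1 - 2 * k)"
    using n unfolding N sum.lessThan_Suc_shift by simp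
  also have "\<dots> = n\<^sup>2 div 4" by (rule sum_odd_steps) simp
  finally show ?thesis by (simp add: f_def)
next
  case False
  then have "S = {}" using S by fastforce
  then show ?thesis by simp
qed

section \<open>Distance along the cycle\<close>

lemma cycle_walk_forward:
  assumes "u < n"
  shows "(u, (u + m) mod n) \<in> {(u, v). {u, v} \<in> cycle_edges n} ^^ m"
proof (induction m)
  case (Suc m)
  have "{(u + m) mod n, (u + Suc m) mod n} \<in> cycle_edges n"
    using assms by (auto simp: cycle_edges_def mod_Suc_eq intro!: exI[of _ "(u + m) mod n"])
  with Suc show ?case by auto
qed (use assms in simp)

text \<open>Each edge changes the vertex by 1 or -1 modulo \<open>n\<close>; \<open>z\<close> adds
  up these signed steps, so the wrap-around edge is no special case.\<close>

lemma cycle_walk_displacement: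
  assumes "(u, v) \<in> {(u, v). {u, v} \<in> cycle_edges n} ^^ m"
  shows "\<exists>z. \<bar>z\<bar> \<le> int m \<and> int n dvd int v - int u - z"
  using assms
proof (induction m arbitrary: v)
  case (Suc m)
  then obtain w where w: "(u, w) \<in> {(u, v). {u, v} \<in> cycle_edges n} ^^ m"
    "{w, v} \<in> cycle_edges n" by auto
  obtain z where z: "\<bar>z\<bar> \<le> int m" "int n dvd int w - int u - z" using Suc.IH[OF w(1)] by auto
  have step: "int n dvd int (Suc i mod n) - int i - 1" for i
  proof -
    have "int (Suc i mod n) - int i - 1 = (int i + 1) mod int n - (int i + 1)"
      by (simp add: of_nat_mod add.commute)
    then show ?thesis by (simp only: mod_eq_dvd_iff[symmetric] mod_mod_trivial)
  qed
  from w(2) obtain i where "{w, v} = {i, Suc i mod n}" by (auto simp: cycle_edges_def)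
  then consider "w = i" "v = Suc i mod n" | "v = i" "w = Suc i mod n"
    by (auto simp: doubleton_eq_iff)
  then show ?case
  proof cases
    case 1
    then have "int n dvd (int w - int u - z) + (int v - int w - 1)"
      using z(2) step[of i] by (intro dvd_add) auto
    then show ?thesis using z(1) by (intro exI[of _ "z + 1"]) (auto simp: algebra_simps)
  next
    case 2
    then have "int n dvd (int w - int u - z) - (int w - int v - 1)"
      using z(2) step[of i] by (intro dvd_diff[of _ "int w - int u - z"]) simp_all
    then show ?thesis using z(1) by (intro exI[of _ "z - 1"]) (auto simp: algebra_simps)
  qed
qed auto

lemma chord_length_eq:
  assumes ij: "i < j" "j < n"
  shows "chord_length n {i, j} = min (j - i) (n - (j - i))"
  unfolding chord_length_def
proof (rule Least_equality)
  let ?R = "{(u, v). {u, v} \<in> cycle_edges n}"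
  have "(i + (j - i)) mod n = j" "(j + (n - (j - i))) mod n = i"
    using ij by (simp_all add: mod_if)
  then have "(i, j) \<in> ?R ^^ (j - i)" "(j, i) \<in> ?R ^^ (n - (j - i))"
    using cycle_walk_forward[of i n "j - i"] cycle_walk_forward[of j n "n - (j - i)"] ij by auto
  \<comment> \<open>The second walk runs from \<open>j\<close> to \<open>i\<close>, which is allowed
    since \<open>chord_length\<close> admits either order of the endpoints.\<close>
  then show "\<exists>i' j'. {i, j} = {i', j'} \<and> (i', j') \<in> ?R ^^ min (j - i) (n - (j - i))"
    by (cases "j - i \<le> n - (j - i)") (auto simp: min_def insert_commute)
next
  fix m assume "\<exists>i' j'. {i, j} = {i', j'} \<and> (i', j') \<in> {(u, v). {u, v} \<in> cycle_edges n} ^^ m"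
  then obtain u v where uv: "{i, j} = {u, v}" "(u, v) \<in> {(u, v). {u, v} \<in> cycle_edges n} ^^ m"
    by blast
  from cycle_walk_displacement[OF uv(2)] obtain z where
    z: "\<bar>z\<bar> \<le> int m" "int n dvd int v - int u - z" by auto
  show "min (j - i) (n - (j - i)) \<le> m"
  proof (rule ccontr)
    assume "\<not> ?thesis"
    then have m: "m < j - i" "m < n - (j - i)" by auto
    have "(u = i \<and> v = j) \<or> (u = j \<and> v = i)" using uv(1) by (auto simp: doubleton_eq_iff)
    \<comment> \<open>Being shorter than \<open>j - i\<close> keeps the difference nonzero; being
      shorter than \<open>n - (j - i)\<close> keeps it below \<open>n\<close>. So \<open>n\<close>
      cannot divide it.\<close>
    then have "0 < \<bar>int v - int u - z\<bar>" "\<bar>int v - int u - z\<bar> < int n"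
      using m z(1) ij by auto
    then show False using z(2) zdvd_imp_le[of "int n" "\<bar>int v - int u - z\<bar>"] by auto
  qed
qed

section \<open>Upper bounds for drawings\<close>

definition chord_pairs :: "drawing \<Rightarrow> (nat \<times> nat) set" where
  "chord_pairs G = {(i, j). i < j \<and> {i, j} \<in> chords G}"

text \<open>Cycle edges are exactly the pairs of consecutive numbers and \<open>{0, n - 1}\<close>.
  Excluding them yields the hypothesis of \<open>card_noncrossing_cyclic\<close> for
  \<open>k = 1\<close>.\<close>

lemma chord_pairs_bounds:
  assumes G: "outerplane_drawing n G" and xy: "(x, y) \<in> chord_pairs G"
  shows "x + 1 < y \<and> y < n \<and> y - x + 1 < n"
proof -
  have "{x, y} \<subseteq> {..<n}" "{x, y} \<notin> cycle_edges n" and less: "x < y"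
    using G xy by (auto simp: outerplane_drawing_def chord_pairs_def)
  then have y: "y < n" and ne: "\<And>i. i < n \<Longrightarrow> {x, y} \<noteq> {i, Suc i mod n}"
    by (auto simp: cycle_edges_def)
  have "y \<noteq> x + 1" using ne[of x] y by auto
  moreover have "\<not> (x = 0 \<and> y = n - 1)" using ne[of "n - 1"] y by auto
  ultimately show ?thesis using less y by linarith
qed

lemma noncrossing_chord_pairs: "outerplane_drawing n G \<Longrightarrow> noncrossing (chord_pairs G)"
  unfolding noncrossing_def chord_pairs_def by (auto dest: outerplane_chords_not_crossing)

lemma bij_betw_chord_pairs:
  assumes "outerplane_drawing n G"
  shows "bij_betw (\<lambda>(i, j). {i, j}) (chord_pairs G) (chords G)"
  unfolding bij_betw_def
proof
  show "inj_on (\<lambda>(i, j). {i, j}) (chord_pairs G)"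
    by (auto simp: inj_on_def chord_pairs_def doubleton_eq_iff)
  have "e \<in> (\<lambda>(i, j). {i, j}) ` chord_pairs G" if e: "e \<in> chords G" for e
  proof -
    have "card e = 2" using assms e by (auto simp: outerplane_drawing_def)
    then obtain i j where "e = {i, j}" "i < j"
      by (metis card_2_iff insert_commute linorder_neqE_nat)
    with e show ?thesis by (force simp: chord_pairs_def)
  qed
  then show "(\<lambda>(i, j). {i, j}) ` chord_pairs G = chords G" by (auto simp: chord_pairs_def)
qed

text \<open>The case \<open>k = 1\<close> of the cyclic count. It also certifies maximality of any
  drawing with \<open>n - 3\<close> chords.\<close>

lemma card_chords_le:
  assumes "outerplane_drawing n G"
  shows "card (chords G) \<le> n - 3"
proof -
  have "card (chord_pairs G) \<le> n - 1 - 2 * 1"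
    using chord_pairs_bounds[OF assms]
    by (intro card_noncrossing_cyclic noncrossing_chord_pairs[OF assms]) auto
  then show ?thesis using bij_betw_same_card[OF bij_betw_chord_pairs[OF assms]] by simp
qed

lemma TCL_le:
  assumes "outerplane_drawing n G"
  shows "TCL n G \<le> n\<^sup>2 div 4 - 2"
proof -
  have "TCL n G = (\<Sum>(x, y)\<in>chord_pairs G. chord_length n {x, y})"
    unfolding TCL_def sum.reindex_bij_betw[OF bij_betw_chord_pairs[OF assms], symmetric]
    by (simp add: case_prod_unfold)
  also have "\<dots> = (\<Sum>(x, y)\<in>chord_pairs G. min (y - x) (n - (y - x)))"
    using chord_pairs_bounds[OF assms] by (intro sum.cong) (force intro!: chord_length_eq)+
  also have "\<dots> \<le> n\<^sup>2 div 4 - 2"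
    by (rule sum_noncrossing_le[OF noncrossing_chord_pairs[OF assms]
          chord_pairs_bounds[OF assms]])
  finally show ?thesis .
qed

section \<open>The zigzag triangulation\<close>

definition root_point :: "nat \<Rightarrow> nat \<Rightarrow> complex" where
  "root_point n i = cis (2 * pi * (real i / real n))"

text \<open>Twice the signed area of the triangle \<open>a\<close>, \<open>c\<close>,
  \<open>z\<close>: positive to the left of the line from \<open>a\<close> to \<open>c\<close>,
  negative to the right.\<close>

definition side :: "complex \<Rightarrow> complex \<Rightarrow> complex \<Rightarrow> real" where
  "side a c z = Im (cnj (c - a) * (z - a))"

lemma side_convex: "side a c ((1 - u) *\<^sub>R p + u *\<^sub>R q) = (1 - u) * side a c p + u * side a c q"
  by (simp add: side_def algebra_simps)

lemma side_endpoints [simp]: "side a c a = 0" "side a c c = 0"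
  by (simp_all add: side_def algebra_simps)

text \<open>The product form, obtained from sum-to-product formulas for the half differences
  \<open>p\<close> and \<open>q\<close>, lets the sign be read off factor by factor.\<close>

lemma side_cis:
  "side (cis \<alpha>) (cis \<gamma>) (cis \<beta>) =
     - 4 * sin ((\<beta> - \<alpha>) / 2) * sin ((\<gamma> - \<beta>) / 2) * sin ((\<gamma> - \<alpha>) / 2)"
proof -
  define p q where "p = (\<beta> - \<alpha>) / 2" and "q = (\<gamma> - \<beta>) / 2"
  have "side (cis \<alpha>) (cis \<gamma>) (cis \<beta>) = sin (\<gamma> - \<alpha>) - sin (\<beta> - \<alpha>) - sin (\<gamma> - \<beta>)"
    by (simp add: side_def sin_diff algebra_simps)
  also have "\<dots> = sin (2 * (p + q)) - (sin (2 * p) + sin (2 * q))"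
  proof -
    have "2 * p = \<beta> - \<alpha>" "2 * q = \<gamma> - \<beta>" "2 * (p + q) = \<gamma> - \<alpha>"
      by (simp_all add: p_def q_def field_simps)
    then show ?thesis by simp
  qed
  also have "sin (2 * p) + sin (2 * q) = 2 * sin (p + q) * cos (p - q)"
    by (simp add: sin_plus_sin add_divide_distrib diff_divide_distrib)
  also have "sin (2 * (p + q)) - 2 * sin (p + q) * cos (p - q)
      = 2 * sin (p + q) * (cos (p + q) - cos (p - q))"
    by (simp only: sin_double right_diff_distrib)
  also have "\<dots> = - 4 * sin p * sin q * sin (p + q)"
    by (simp add: cos_add cos_diff algebra_simps)
  finally show ?thesis by (simp add: p_def q_def add_divide_distrib[symmetric])
qed

text \<open>All three half differences of the angles lie strictly between 0 and \<open>pi\<close>,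
  so every sine in \<open>side_cis\<close> is positive.\<close>

lemma side_root_point_neg:
  assumes "i < l" "l < j" "j < n"
  shows "side (root_point n i) (root_point n j) (root_point n l) < 0"
proof -
  have *: "0 < sin ((2 * pi * (real y / real n) - 2 * pi * (real x / real n)) / 2)"
    if "x < y" "y < n" for x y
  proof -
    have "(2 * pi * (real y / real n) - 2 * pi * (real x / real n)) / 2
        = pi * ((real y - real x) / real n)"
      by (simp add: diff_divide_distrib right_diff_distrib)
    moreover have "0 < (real y - real x) / real n" "(real y - real x) / real n < 1"
      using that by simp_all
    ultimately show ?thesis using sin_gt_zero[of "pi * ((real y - real x) / real n)"] pi_gt_zero
      by (metis mult.right_neutral mult_pos_pos mult_strict_left_mono)
  qed
  show ?thesis
    unfolding root_point_def side_cis using *[of i l] *[of l j] *[of i j] assms by simp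
qed

lemma root_point_eq_iff:
  assumes "i < n" "j < n"
  shows "root_point n i = root_point n j \<longleftrightarrow> i = j"
proof
  assume eq: "root_point n i = root_point n j"
  have "exp (2 * of_real pi * \<i> * of_nat i / of_nat n) = exp (2 * of_real pi * \<i> * of_nat j / of_nat n)"
    using eq by (simp add: root_point_def cis_conv_exp mult_ac)
  then show "i = j"
    using complex_root_unity_eq[of n i j] assms by (simp add: cong_def)
qed simp

text \<open>\<open>side\<close> relative to the outer segment vanishes at \<open>z\<close>, yet is
  negative at every endpoint of the inner segment that is not shared. A convex combination of these
  values is 0 only at a shared endpoint.\<close>

lemma nested_segments_meet:
  assumes le: "i \<le> i'" "i' < j'" "j' \<le> j" "j < n" and ne: "(i, j) \<noteq> (i', j')"
    and z: "z \<in> closed_segment (root_point n i) (root_point n j)"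
      "z \<in> closed_segment (root_point n i') (root_point n j')"
  shows "z \<in> root_point n ` ({i, j} \<inter> {i', j'})"
proof -
  let ?F = "side (root_point n i) (root_point n j)"
  obtain t where "z = (1 - t) *\<^sub>R root_point n i + t *\<^sub>R root_point n j"
    using z(1) by (auto simp: in_segment)
  then have F0: "?F z = 0" by (simp add: side_convex)
  obtain u where u: "0 \<le> u" "u \<le> 1" and zu: "z = (1 - u) *\<^sub>R root_point n i' + u *\<^sub>R root_point n j'"
    using z(2) by (auto simp: in_segment)
  have Fu: "(1 - u) * ?F (root_point n i') + u * ?F (root_point n j') = 0"
    using F0 zu by (simp add: side_convex)
  consider "i' = i" "j' < j" | "i < i'" "j' = j" | "i < i'" "j' < j" using le ne by force
  then show ?thesis
  proof cases
    case 1
    then have "?F (root_point n j') < 0" using le by (intro side_root_point_neg) auto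
    then have "u = 0" using Fu 1 by simp
    then show ?thesis using zu 1 by simp
  next
    case 2
    then have "?F (root_point n i') < 0" using le by (intro side_root_point_neg) auto
    then have "u = 1" using Fu 2 by simp
    then show ?thesis using zu 2 by simp
  next
    case 3
    have "?F (root_point n i') < 0" "?F (root_point n j') < 0"
      using le 3 by (auto intro!: side_root_point_neg)
    then have "(1 - u) * ?F (root_point n i') + u * ?F (root_point n j') < 0"
      using u by (cases "u = 0") (auto simp: mult_nonneg_nonpos mult_pos_neg add_nonpos_neg)
    with Fu show ?thesis by simp
  qed
qed

section \<open>Zigzag chords and their drawing\<close>

text \<open>Starting from \<open>{1, n - 1}\<close> at \<open>t = 1\<close>, the upper and the lower
  end move inwards alternately, so the span is \<open>n - 1 - t\<close>. The values
  \<open>t = 0\<close> and \<open>t = n - 2\<close> would give cycle edges.\<close>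

definition zigzag :: "nat \<Rightarrow> nat \<Rightarrow> nat set" where
  "zigzag n t = {(t + 1) div 2, n - 1 - t div 2}"

text \<open>\<open>Min\<close> and \<open>Max\<close> recover an ordered pair of endpoints from a
  chord, which is only a set.\<close>

definition zigzag_drawing :: "nat \<Rightarrow> drawing" where
  "zigzag_drawing n = \<lparr>outer = circlepath 0 1, mark = (\<lambda>i. real i / real n),
     chords = zigzag n ` {1..n - 3},
     chord_path = (\<lambda>e. linepath (root_point n (Min e)) (root_point n (Max e)))\<rparr>"

lemma zigzag_bounds:
  fixes n t :: nat
  assumes "t \<in> {1..n - 3}"
  shows "1 \<le> (t + 1) div 2" "(t + 1) div 2 < n - 1 - t div 2" "n - 1 - t div 2 < n"
    "n - 1 - t div 2 - (t + 1) div 2 = n - 1 - t"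
proof -
  have "t div 2 + (t + 1) div 2 = t" by presburger
  then show "1 \<le> (t + 1) div 2" "(t + 1) div 2 < n - 1 - t div 2" "n - 1 - t div 2 < n"
      "n - 1 - t div 2 - (t + 1) div 2 = n - 1 - t"
    using assms by auto
qed

lemma zigzag_nested:
  fixes n s t :: nat
  assumes "s \<in> {1..n - 3}" "t \<in> {1..n - 3}" "s < t"
  shows "(s + 1) div 2 \<le> (t + 1) div 2" "n - 1 - t div 2 \<le> n - 1 - s div 2"
    "((s + 1) div 2, n - 1 - s div 2) \<noteq> ((t + 1) div 2, n - 1 - t div 2)"
proof -
  show "(s + 1) div 2 \<le> (t + 1) div 2" "n - 1 - t div 2 \<le> n - 1 - s div 2"
    using assms(3) by (auto intro!: div_le_mono diff_le_mono2)
  have "n - 1 - s \<noteq> n - 1 - t" using assms by auto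
  then show "((s + 1) div 2, n - 1 - s div 2) \<noteq> ((t + 1) div 2, n - 1 - t div 2)"
    using zigzag_bounds(4)[OF assms(1)] zigzag_bounds(4)[OF assms(2)] by (metis prod.inject)
qed

lemma inj_on_zigzag: "inj_on (zigzag n) {1..n - 3}"
proof (rule linorder_inj_onI)
  fix s t assume st: "s < t" "s \<in> {1..n - 3}" "t \<in> {1..n - 3}"
  have pair: "a = c \<and> b = d" if "{a, b} = {c, d}" "a < b" "c < d" for a b c d :: nat
    using that by (auto simp: doubleton_eq_iff)
  show "zigzag n s \<noteq> zigzag n t"
  proof
    assume "zigzag n s = zigzag n t"
    from pair[OF this[unfolded zigzag_def] zigzag_bounds(2)[OF st(2)] zigzag_bounds(2)[OF st(3)]]
    show False using zigzag_nested(3)[OF st(2,3,1)] by blast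
  qed
qed (rule linear)

lemma vertex_zigzag_drawing: "vertex (zigzag_drawing n) i = root_point n i"
  by (simp add: vertex_def zigzag_drawing_def circlepath root_point_def cis_conv_exp mult_ac)

lemma inside_unit_sphere: "inside (sphere 0 1) = ball (0 :: complex) 1"
  using inside_frontier_eq_interior[of "cball (0 :: complex) 1"] by simp

lemma open_segment_root_point_subset:
  assumes "i < n" "j < n"
  shows "open_segment (root_point n i) (root_point n j) \<subseteq> ball 0 1"
proof
  fix z assume "z \<in> open_segment (root_point n i) (root_point n j)"
  then show "z \<in> ball 0 1"
    using dist_decreases_open_segment[of z "root_point n i" "root_point n j" 0]
    by (auto simp: root_point_def)
qed

lemma chord_path_zigzag:
  assumes "t \<in> {1..n - 3}"
  shows "chord_path (zigzag_drawing n) (zigzag n t) =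
    linepath (root_point n ((t + 1) div 2)) (root_point n (n - 1 - t div 2))"
  using zigzag_bounds(2)[OF assms] by (simp add: zigzag_drawing_def zigzag_def)

lemma outerplane_zigzag_drawing:
  assumes "n \<ge> 5"
  shows "outerplane_drawing n (zigzag_drawing n)"
proof -
  let ?G = "zigzag_drawing n"
  have sel: "outer ?G = circlepath 0 1" "mark ?G = (\<lambda>i. real i / real n)"
      "chords ?G = zigzag n ` {1..n - 3}"
    by (simp_all add: zigzag_drawing_def)
  have chord: "zigzag n t \<subseteq> {..<n} \<and> card (zigzag n t) = 2 \<and> zigzag n t \<notin> cycle_edges n \<and>
        arc (chord_path ?G (zigzag n t)) \<and>
        {pathstart (chord_path ?G (zigzag n t)), pathfinish (chord_path ?G (zigzag n t))} =
          vertex ?G ` zigzag n t \<and>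
        path_image (chord_path ?G (zigzag n t)) - vertex ?G ` zigzag n t
          \<subseteq> inside (path_image (outer ?G))"
    if t: "t \<in> {1..n - 3}" for t
  proof -
    define a b where "a = (t + 1) div 2" and "b = n - 1 - t div 2"
    have ab: "1 \<le> a" "a < b" "b < n" "b - a = n - 1 - t" and zz: "zigzag n t = {a, b}"
      using zigzag_bounds[OF t] by (simp_all add: a_def b_def zigzag_def)
    have "{a, b} \<notin> cycle_edges n"
    proof
      assume "{a, b} \<in> cycle_edges n"
      then obtain i where i: "i < n" "{a, b} = {i, Suc i mod n}" by (auto simp: cycle_edges_def)
      \<comment> \<open>Span at least 2 excludes consecutive numbers; the wrap-around edge contains
        0, whereas \<open>1 \<le> a\<close>.\<close>
      have "b - a \<ge> 2" using ab(4) t by auto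
      then show False using i ab by (cases "Suc i = n") (auto simp: doubleton_eq_iff)
    qed
    moreover have "root_point n a \<noteq> root_point n b" using ab by (simp add: root_point_eq_iff)
    moreover have "path_image (linepath (root_point n a) (root_point n b))
        - {root_point n a, root_point n b} \<subseteq> ball 0 1"
      using open_segment_root_point_subset[of a n b] ab by (simp add: open_segment_def)
    moreover have "chord_path ?G {a, b} = linepath (root_point n a) (root_point n b)"
      using chord_path_zigzag[OF t] by (simp add: zz a_def b_def)
    ultimately show ?thesis
      using ab by (simp add: zz vertex_zigzag_drawing sel inside_unit_sphere)
  qed
  have cross: "path_image (chord_path ?G (zigzag n s)) \<inter> path_image (chord_path ?G (zigzag n t))
      \<subseteq> vertex ?G ` (zigzag n s \<inter> zigzag n t)"
    if st: "s \<in> {1..n - 3}" "t \<in> {1..n - 3}" "s < t" for s t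
  proof
    fix z assume z: "z \<in> path_image (chord_path ?G (zigzag n s)) \<inter> path_image (chord_path ?G (zigzag n t))"
    have "z \<in> root_point n ` ({(s + 1) div 2, n - 1 - s div 2} \<inter> {(t + 1) div 2, n - 1 - t div 2})"
      using z unfolding chord_path_zigzag[OF st(1)] chord_path_zigzag[OF st(2)]
      by (intro nested_segments_meet[OF zigzag_nested(1)[OF st] zigzag_bounds(2)[OF st(2)]
            zigzag_nested(2)[OF st] zigzag_bounds(3)[OF st(1)] zigzag_nested(3)[OF st]]) simp_all
    moreover have "vertex ?G = root_point n" by (rule ext) (rule vertex_zigzag_drawing)
    ultimately show "z \<in> vertex ?G ` (zigzag n s \<inter> zigzag n t)" by (simp add: zigzag_def)
  qed
  show ?thesis
    unfolding outerplane_drawing_def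
  proof (intro conjI)
    show "simple_path (outer ?G)" "pathfinish (outer ?G) = pathstart (outer ?G)"
      by (simp_all add: sel simple_path_circlepath)
    show "mark ?G ` {..<n} \<subseteq> {0..<1}" "strict_mono_on {..<n} (mark ?G)"
      by (auto simp: sel strict_mono_on_def divide_strict_right_mono)
    show "\<forall>e\<in>chords ?G. e \<subseteq> {..<n} \<and> card e = 2 \<and> e \<notin> cycle_edges n \<and>
        arc (chord_path ?G e) \<and>
        {pathstart (chord_path ?G e), pathfinish (chord_path ?G e)} = vertex ?G ` e \<and>
        path_image (chord_path ?G e) - vertex ?G ` e \<subseteq> inside (path_image (outer ?G))"
      unfolding sel(3) using chord by blast
    show "\<forall>e\<in>chords ?G. \<forall>f\<in>chords ?G. e \<noteq> f \<longrightarrow>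
        path_image (chord_path ?G e) \<inter> path_image (chord_path ?G f) \<subseteq> vertex ?G ` (e \<inter> f)"
      unfolding sel(3)
    proof (intro ballI impI)
      fix e f assume e: "e \<in> zigzag n ` {1..n - 3}" and f: "f \<in> zigzag n ` {1..n - 3}" and "e \<noteq> f"
      obtain s where s: "s \<in> {1..n - 3}" "e = zigzag n s" using e by blast
      obtain t where t: "t \<in> {1..n - 3}" "f = zigzag n t" using f by blast
      have "s \<noteq> t" using \<open>e \<noteq> f\<close> s(2) t(2) by blast
      then consider "s < t" | "t < s" by (rule linorder_neqE_nat)
      then show "path_image (chord_path ?G e) \<inter> path_image (chord_path ?G f) \<subseteq> vertex ?G ` (e \<inter> f)"
      proof cases
        case 1
        then show ?thesis unfolding s(2) t(2) by (rule cross[OF s(1) t(1)])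
      next
        case 2
        then show ?thesis
          unfolding s(2) t(2) Int_commute[of "zigzag n s"]
            Int_commute[of "path_image (chord_path ?G (zigzag n s))"]
          by (rule cross[OF t(1) s(1)])
      qed
    qed
  qed
qed

text \<open>One more chord, however drawn, would exceed the bound \<open>n - 3\<close> of
  \<open>card_chords_le\<close>.\<close>

lemma maximal_zigzag_drawing:
  assumes "n \<ge> 5"
  shows "maximal_outerplanar n (zigzag_drawing n)"
  unfolding maximal_outerplanar_def
proof (intro conjI notI)
  let ?G = "zigzag_drawing n"
  show "outerplane_drawing n ?G" by (rule outerplane_zigzag_drawing[OF assms])
  have ch: "chords ?G = zigzag n ` {1..n - 3}" by (simp add: zigzag_drawing_def)
  let ?G' = "\<lambda>e g. ?G\<lparr>chords := insert e (chords ?G), chord_path := (chord_path ?G)(e := g)\<rparr>"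
  assume "\<exists>e g. e \<notin> chords ?G \<and> outerplane_drawing n (?G' e g)"
  then obtain e g where e: "e \<notin> chords ?G" and G': "outerplane_drawing n (?G' e g)"
    by (elim exE conjE)
  from card_chords_le[OF G'] have "card (insert e (chords ?G)) \<le> n - 3" by simp
  moreover have "card (chords ?G) = n - 3" using card_image[OF inj_on_zigzag] by (simp add: ch)
  moreover have "finite (chords ?G)" by (simp add: ch)
  ultimately show False using e by simp
qed

text \<open>The same layer-cake sum as in the upper bound, now with equality at each level.\<close>

lemma TCL_zigzag_drawing:
  assumes "n \<ge> 5"
  shows "TCL n (zigzag_drawing n) = n\<^sup>2 div 4 - 2"
proof -
  define f where "f t = min (n - 1 - t) (t + 1)" for t
  have "TCL n (zigzag_drawing n) = (\<Sum>t\<in>{1..n - 3}. chord_length n (zigzag n t))"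
    using sum.reindex[OF inj_on_zigzag] by (simp add: TCL_def zigzag_drawing_def comp_def)
  also have "\<dots> = sum f {1..n - 3}"
  proof (rule sum.cong)
    fix t assume t: "t \<in> {1..n - 3}"
    have "n - (n - 1 - t) = t + 1" using t by auto
    then show "chord_length n (zigzag n t) = f t"
      unfolding zigzag_def f_def chord_length_eq[OF zigzag_bounds(2,3)[OF t]] zigzag_bounds(4)[OF t]
      by (simp only:)
  qed simp
  also have "\<dots> = (\<Sum>k<n. card {t \<in> {1..n - 3}. k < f t})"
    by (rule sum_eq_sum_card_less) (auto simp: f_def)
  finally have TCL: "TCL n (zigzag_drawing n) = (\<Sum>k<n. card {t \<in> {1..n - 3}. k < f t})" .
  obtain N where N: "n = Suc N" using assms by (cases n) auto
  have c0: "card {t \<in> {1..n - 3}. 0 < f t} = n - 3"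
  proof -
    have "{t \<in> {1..n - 3}. 0 < f t} = {1..n - 3}" by (auto simp: f_def)
    then show ?thesis by simp
  qed
  have c: "card {t \<in> {1..n - 3}. Suc k < f t} = n - 1 - 2 * Suc k" for k
  proof -
    \<comment> \<open>The two arguments of \<open>min\<close> give the two ends of the interval; as
      \<open>Suc k\<close> is at least 1, it stays within \<open>{1..n - 3}\<close>.\<close>
    have "{t \<in> {1..n - 3}. Suc k < f t} = {Suc k..<n - 1 - Suc k}" by (auto simp: f_def)
    then show ?thesis by simp
  qed
  have "TCL n (zigzag_drawing n) + 2 = (n - 3) + 2 + (\<Sum>k<N. n - 1 - 2 * Suc k)"
    unfolding TCL using c0 c by (simp add: N sum.lessThan_Suc_shift del: sum.lessThan_Suc)
  also have "\<dots> = (\<Sum>k<n. n - 1 - 2 * k)"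
    using assms unfolding N sum.lessThan_Suc_shift by simp
  also have "\<dots> = n\<^sup>2 div 4" by (rule sum_odd_steps) simp
  finally show ?thesis by simp
qed

section \<open>Closed form and conclusion\<close>

lemma real_square_div_4_minus_2:
  fixes n :: nat
  assumes "n \<ge> 3"
  shows "real (n\<^sup>2 div 4 - 2) = (if odd n then ((real n)\<^sup>2 - 9) / 4 else ((real n)\<^sup>2 - 8) / 4)"
proof (cases "odd n")
  case True
  then obtain m where m: "n = 2 * m + 1" by (elim oddE)
  have "n\<^sup>2 = 1 + 4 * (m * (m + 1))" by (simp add: m power2_eq_square algebra_simps)
  then have "n\<^sup>2 div 4 = m * (m + 1)" by simp
  \<comment> \<open>The quotient is at least 2, so subtracting 2 in the naturals agrees with
    subtraction in the reals.\<close>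
  moreover have "1 * (1 + 1) \<le> m * (m + 1)" using assms m by (intro mult_mono) auto
  ultimately show ?thesis using True by (simp add: m power2_eq_square of_nat_diff field_simps)
next
  case False
  then obtain m where m: "n = 2 * m" by (auto elim: evenE)
  have "n\<^sup>2 div 4 = m * m" by (simp add: m power2_eq_square)
  moreover have "2 * 2 \<le> m * m" using assms m by (intro mult_mono) auto
  ultimately show ?thesis using False by (simp add: m power2_eq_square of_nat_diff field_simps)
qed

text \<open>\<open>Max\<close> is meaningful only on finite nonempty sets, so both properties are
  asserted together with its value.\<close>

theorem theorem2:
  fixes n :: nat
  assumes "n \<ge> 5"
  shows "finite (TCL_values n) \<and> TCL_values n \<noteq> {} \<and>
    real (Max (TCL_values n)) =
      (if odd n then ((real n)\<^sup>2 - 9) / 4 else ((real n)\<^sup>2 - 8) / 4)"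
proof -
  have bound: "x \<le> n\<^sup>2 div 4 - 2" if "x \<in> TCL_values n" for x
    using that by (auto simp: TCL_values_def maximal_outerplanar_def intro: TCL_le)
  then have "TCL_values n \<subseteq> {..n\<^sup>2 div 4 - 2}" by blast
  then have fin: "finite (TCL_values n)" by (rule finite_subset) simp
  have mem: "n\<^sup>2 div 4 - 2 \<in> TCL_values n"
    using maximal_zigzag_drawing[OF assms] TCL_zigzag_drawing[OF assms]
    by (force simp: TCL_values_def)
  have "Max (TCL_values n) = n\<^sup>2 div 4 - 2"
    by (rule Max_eqI[OF fin bound mem])
  then show ?thesis using fin mem real_square_div_4_minus_2[of n] assms by auto
qed

end
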